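(* Let $(x^k,y^k,u^k)$ be generated by Algorithm (DFG) and let $v^k=u(x^k)=\arg\min_{v\in U}\mathcal{L}(v,x^k)$. Then the last primal iterate $v^k$ is an $\epsilon$-primal solution of (P) after $k=\mathcal{O}(1/\epsilon)$ iterations; that is, there exist constants $C_1,C_2>0$, independent of $\epsilon$ and $k$, such that for every $\epsilon>0$ and every integer $k\ge1$ with $k\ge C_1/\epsilon$, $$\mathrm{dist}_{\mathcal{K}}(Gv^k+g)\le C_2\,\epsilon \quad\text{and}\quad -C_2\,\epsilon\le f(v^k)-f^*\le C_2\,\epsilon .$$
   Context: Problem (P): $f^* = \min_{u \in U} f(u)$ subject to $Gu + g \in \mathcal{K}$, where $f:\mathbb{R}^n \to \mathbb{R}$ is $\sigma_{\mathrm f}$-strongly convex with respect to the Euclidean norm $\|\cdot\|$ ($\sigma_{\mathrm f}>0$), $G \in \mathbb{R}^{p\times n}$ ($G\ne 0$), $g \in \mathbb{R}^p$, $\mathcal{K}\subseteq\mathbb{R}^p$ is a proper cone (closed, convex, pointed, nonempty interior), and $U \subseteq \mathbb{R}^n$ is a nonempty closed convex set. $\mathcal{K}^* = \{x : \langle x,z\rangle \ge 0\ \forall z\in\mathcal{K}\}$ is the dual cone. The Lagrangian is $\mathcal{L}(u,x) = f(u) - \langle x, Gu+g\rangle$, the dual function is $d(x) = \min_{u\in U}\mathcal{L}(u,x)$ for $x \in \mathbb{R}^p$, and $u(x)$ is the unique minimizer of $\mathcal{L}(\cdot,x)$ over $U$. The function $d$ is concave and differentiable on $\mathbb{R}^p$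 with $\nabla d(x) = -Gu(x)-g$, Lipschitz with constant $L_{\mathrm d} = \|G\|^2/\sigma_{\mathrm f}$ ($\|G\|$ the spectral norm). Standing assumption: there exists a finite optimal Lagrange multiplier for the conic constraint, so that $f^* = \max_{x\in\mathcal{K}^*} d(x)$ and the set $X^*\subseteq\mathcal{K}^*$ of maximizers is nonempty. $[z]_C$ denotes Euclidean projection onto $C$ and $\mathrm{dist}_C(z)=\min_{w\in C}\|w-z\|$. Algorithm (DFG): given $x^0=y^1\in\mathcal{K}^*$ and $\theta_1=1$, for $k\ge1$ compute $u^k=u(y^k)=\arg\min_{u\in U}\mathcal{L}(u,y^k)$, $x^k=\left[y^k+\frac{1}{L_{\mathrm d}}\nabla d(y^k)\right]_{\mathcal{K}^*}$, $\theta_{k+1}=\frac{1+\sqrt{1+4\theta_k^2}}{2}$, and $y^{k+1}=x^k+\frac{\theta_k-1}{\theta_{k+1}}(x^k-x^{k-1})$. $\tilde u\in U$ is an $\epsilon$-primal solution if $\mathrm{dist}_{\mathcal{K}}(G\tilde u+g)\le\mathcal{O}(\epsilon)$ and $-\mathcal{O}(\epsilon)\le f(\tilde u)-f^*\le\mathcal{O}(\epsilon)$; constants in $\mathcal{O}$ may depend on the problem data and $x^0$, but not on $\epsilon$ or $k$. *)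

theory Defs
  imports "HOL-Analysis.Analysis"
begin

definition strongly_convex :: "real \<Rightarrow> ('a::real_normed_vector \<Rightarrow> real) \<Rightarrow> bool" where
  "strongly_convex \<sigma> f \<longleftrightarrow>
     (\<forall>x y t. 0 \<le> t \<longrightarrow> t \<le> 1 \<longrightarrow>
        f (t *\<^sub>R x + (1 - t) *\<^sub>R y)
          \<le> t * f x + (1 - t) * f y - \<sigma> / 2 * t * (1 - t) * (norm (x - y))\<^sup>2)"

definition proper_cone :: "'a::euclidean_space set \<Rightarrow> bool" where
  "proper_cone K \<longleftrightarrow>
     cone K \<and> closed K \<and> convex K \<and> K \<inter> uminus ` K = {0} \<and> interior K \<noteq> {}"

definition dual_cone :: "'a::real_inner set \<Rightarrow> 'a set" where
  "dual_cone K = {x. \<forall>z\<in>K. 0 \<le> x \<bullet> z}"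

definition gradient :: "('a::real_inner \<Rightarrow> real) \<Rightarrow> 'a \<Rightarrow> 'a" where
  "gradient h x = (THE D. GDERIV h x :> D)"

(* The minima in opt_val and dual_fun are written as infima. The minimum in dual_fun is attained
   if f is strongly convex (with positive modulus) and U is closed, convex and nonempty, and the
   minimum in opt_val is attained if moreover K is closed and the feasible set is nonempty. *)

definition feasible_set ::
    "real^'n^'p \<Rightarrow> real^'p \<Rightarrow> (real^'p) set \<Rightarrow> (real^'n) set \<Rightarrow> (real^'n) set" where
  "feasible_set G g K U = {u \<in> U. G *v u + g \<in> K}"

definition opt_val ::
    "(real^'n \<Rightarrow> real) \<Rightarrow> real^'n^'p \<Rightarrow> real^'p \<Rightarrow> (real^'p) set \<Rightarrow> (real^'n) set \<Rightarrow> real" where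
  "opt_val f G g K U = (INF u\<in>feasible_set G g K U. f u)"

definition lagrangian ::
    "(real^'n \<Rightarrow> real) \<Rightarrow> real^'n^'p \<Rightarrow> real^'p \<Rightarrow> real^'n \<Rightarrow> real^'p \<Rightarrow> real" where
  "lagrangian f G g u x = f u - x \<bullet> (G *v u + g)"

definition dual_fun ::
    "(real^'n \<Rightarrow> real) \<Rightarrow> real^'n^'p \<Rightarrow> real^'p \<Rightarrow> (real^'n) set \<Rightarrow> real^'p \<Rightarrow> real" where
  "dual_fun f G g U x = (INF u\<in>U. lagrangian f G g u x)"

definition lagr_argmin ::
    "(real^'n \<Rightarrow> real) \<Rightarrow> real^'n^'p \<Rightarrow> real^'p \<Rightarrow> (real^'n) set \<Rightarrow> real^'p \<Rightarrow> real^'n" where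
  "lagr_argmin f G g U x = arg_min_on (\<lambda>u. lagrangian f G g u x) U"

definition dual_optimal_set ::
    "(real^'n \<Rightarrow> real) \<Rightarrow> real^'n^'p \<Rightarrow> real^'p \<Rightarrow> (real^'p) set \<Rightarrow> (real^'n) set \<Rightarrow> (real^'p) set"
  where
  "dual_optimal_set f G g K U = {x. is_arg_max (dual_fun f G g U) (\<lambda>z. z \<in> dual_cone K) x}"

definition dual_lipschitz :: "real \<Rightarrow> real^'n^'p \<Rightarrow> real" where
  "dual_lipschitz \<sigma> G = (onorm ((*v) G))\<^sup>2 / \<sigma>"

(* The sequence x is indexed from 0; y, u and \<theta> are indexed from 1, and their values at 0
   are unconstrained. *)
definition dfg_sequence ::
    "(real^'n \<Rightarrow> real) \<Rightarrow> real \<Rightarrow> real^'n^'p \<Rightarrow> real^'p \<Rightarrow> (real^'p) set \<Rightarrow> (real^'n) set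
      \<Rightarrow> (nat \<Rightarrow> real^'p) \<Rightarrow> (nat \<Rightarrow> real^'p) \<Rightarrow> (nat \<Rightarrow> real^'n) \<Rightarrow> (nat \<Rightarrow> real) \<Rightarrow> bool" where
  "dfg_sequence f \<sigma> G g K U x y u \<theta> \<longleftrightarrow>
     x 0 \<in> dual_cone K \<and> y 1 = x 0 \<and> \<theta> 1 = 1 \<and>
     (\<forall>k\<ge>1.
        u k = lagr_argmin f G g U (y k) \<and>
        x k = closest_point (dual_cone K)
                (y k + (1 / dual_lipschitz \<sigma> G) *\<^sub>R gradient (dual_fun f G g U) (y k)) \<and>
        \<theta> (k + 1) = (1 + sqrt (1 + 4 * (\<theta> k)\<^sup>2)) / 2 \<and>
        y (k + 1) = x k + ((\<theta> k - 1) / \<theta> (k + 1)) *\<^sub>R (x k - x (k - 1)))"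

end

theory Submission
  imports Defs
begin

text \<open>
  Let \<open>d\<close> be the dual function, \<open>x\<^sup>*\<close> a dual maximiser, \<open>R = \<parallel>x\<^sup>0 - x\<^sup>*\<parallel>\<close> and \<open>u\<^sup>*\<close> a primal
  minimiser.  Strong convexity makes every Lagrangian grow quadratically around its minimiser over
  \<open>U\<close>.  Everything rests on this single fact, which is used twice.

  The first use is on the dual side.  Comparing the Lagrangian minimisers \<open>u(z)\<close> and \<open>u(y)\<close> traps
  \<open>d(z)\<close> between its linearisation at \<open>y\<close> (from above) and that linearisation minus
  \<open>L/2 \<parallel>z - y\<parallel>\<^sup>2\<close>, where \<open>L = \<parallel>G\<parallel>\<^sup>2/\<sigma>\<close> (\<open>dual_le_linearization\<close>, \<open>dual_ge_quadratic\<close>).  So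
  the gradient of \<open>d\<close> at \<open>y\<close> is \<open>-(G u(y) + g)\<close>, and the iteration is accelerated projected gradient
  ascent on a smooth concave function.  The estimate sequence argument (\<open>accelerated_potential\<close>)
  gives \<open>d(x\<^sup>*) - d(x\<^sup>k) \<le> 2 L R\<^sup>2/(k+1)\<^sup>2\<close>, and the same potential keeps all iterates \<open>x\<^sup>k\<close>
  in the ball of radius \<open>R\<close> around \<open>x\<^sup>*\<close>.

  The second use is on the primal side.  The value at \<open>u\<^sup>*\<close> of the Lagrangian with multiplier \<open>x\<^sup>k\<close>
  is at most \<open>f\<^sup>* = d(x\<^sup>*)\<close>, and its minimum \<open>d(x\<^sup>k)\<close> is attained at \<open>v\<^sup>k\<close>.  Quadratic growth
  therefore yields \<open>\<sigma>/2 \<parallel>v\<^sup>k - u\<^sup>*\<parallel>\<^sup>2 \<le> d(x\<^sup>*) - d(x\<^sup>k)\<close>, hence \<open>\<parallel>v\<^sup>k - u\<^sup>*\<parallel> = O(1/k)\<close>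
  (\<open>argmin_dist_le_gap\<close>).  Infeasibility is at most \<open>\<parallel>G (v\<^sup>k - u\<^sup>*)\<parallel>\<close>, and the Lagrangian
  inequalities at \<open>x\<^sup>k\<close> and \<open>x\<^sup>*\<close> give
  \<open>\<langle>x\<^sup>*, G (v\<^sup>k - u\<^sup>*)\<rangle> \<le> f(v\<^sup>k) - f\<^sup>* \<le> \<langle>x\<^sup>k, G (v\<^sup>k - u\<^sup>*)\<rangle>\<close>.  Both ends are \<open>O(1/k)\<close> because
  the iterates \<open>x\<^sup>k\<close> are bounded.
\<close>

section \<open>Minimising strongly convex functions\<close>

lemma strongly_convex_imp_convex_on:
  assumes "strongly_convex \<sigma> f" and "\<sigma> \<ge> 0"
  shows "convex_on UNIV f"
proof (rule convex_onI)
  fix t :: real and x y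
  assume t: "0 < t" "t < 1"
  have "f ((1 - t) *\<^sub>R x + t *\<^sub>R y)
      \<le> t * f y + (1 - t) * f x - \<sigma> / 2 * t * (1 - t) * (norm (y - x))\<^sup>2"
    using assms(1)[unfolded strongly_convex_def, rule_format, of t y x] t by (simp add: add.commute)
  moreover have "0 \<le> \<sigma> / 2 * t * (1 - t) * (norm (y - x))\<^sup>2"
    using t assms(2) by simp
  ultimately show "f ((1 - t) *\<^sub>R x + t *\<^sub>R y) \<le> (1 - t) * f x + t * f y" by linarith
qed simp

text \<open>
  On the unit sphere around \<open>a\<close> continuity bounds \<open>f\<close> below by some \<open>m\<close>.  Along a ray from \<open>a\<close>
  through that sphere the strong convexity inequality turns this into
  \<open>f u - f a \<ge> r (m - f a + \<sigma>/2 (r - 1))\<close> at distance \<open>r\<close>, so \<open>f \<ge> f a\<close> outside a large ball and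
  only a compact part of \<open>U\<close> matters.
\<close>
lemma strongly_convex_attains_min:
  fixes f :: "'a::euclidean_space \<Rightarrow> real"
  assumes sc: "strongly_convex \<sigma> f" and \<sigma>: "\<sigma> > 0"
    and U: "U \<noteq> {}" "closed U"
  obtains u where "u \<in> U" "\<And>w. w \<in> U \<Longrightarrow> f u \<le> f w"
proof -
  obtain a where a: "a \<in> U" using U by blast
  have cont: "continuous_on UNIV f"
    using convex_on_continuous[OF open_UNIV] strongly_convex_imp_convex_on[OF sc] \<sigma> by simp
  have "\<exists>c\<in>cball a 1. \<forall>z\<in>cball a 1. f c \<le> f z"
    by (rule continuous_attains_inf) (auto intro: continuous_on_subset[OF cont])
  then obtain m where m: "\<And>z. z \<in> cball a 1 \<Longrightarrow> m \<le> f z" by blast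
  define r0 where "r0 = 1 + 2 * (f a - m) / \<sigma>"
  have m_le: "m \<le> f a" using m[of a] by simp
  then have r0: "r0 \<ge> 1" using \<sigma> by (simp add: r0_def)
  have far: "f a \<le> f w" if w: "norm (w - a) \<ge> r0" for w
  proof -
    define r where "r = norm (w - a)"
    have r: "r \<ge> 1" "r \<ge> r0" using w r0 by (auto simp: r_def)
    define z where "z = (1 / r) *\<^sub>R w + (1 - 1 / r) *\<^sub>R a"
    have "z - a = (1 / r) *\<^sub>R (w - a)" by (simp add: z_def algebra_simps)
    then have "norm (z - a) = 1" using r by (simp add: r_def[symmetric])
    then have "m \<le> f z" using m by (simp add: dist_norm norm_minus_commute)
    also have "f z \<le> 1 / r * f w + (1 - 1 / r) * f a - \<sigma> / 2 * (1 / r) * (1 - 1 / r) * r\<^sup>2"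
      using sc[unfolded strongly_convex_def, rule_format, of "1 / r" w a] r(1)
      unfolding z_def r_def[symmetric] by simp
    also have "\<sigma> / 2 * (1 / r) * (1 - 1 / r) * r\<^sup>2 = \<sigma> / 2 * (r - 1)"
      using r by (simp add: field_simps power2_eq_square)
    finally have "m \<le> 1 / r * f w + (1 - 1 / r) * f a - \<sigma> / 2 * (r - 1)" .
    moreover have "f a - m \<le> \<sigma> / 2 * (r - 1)"
      using r(2) \<sigma> by (simp add: r0_def field_simps)
    moreover have "1 / r * f w + (1 - 1 / r) * f a = f a + 1 / r * (f w - f a)"
      by (simp add: algebra_simps)
    ultimately have "0 \<le> 1 / r * (f w - f a)" by linarith
    then show ?thesis using r(1) by (simp add: zero_le_divide_iff)
  qed
  have "\<exists>c\<in>U \<inter> cball a r0. \<forall>z\<in>U \<inter> cball a r0. f c \<le> f z"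
    using a r0 U
    by (intro continuous_attains_inf)
       (auto intro: continuous_on_subset[OF cont] closed_Int_compact)
  then obtain c where c: "c \<in> U" "\<And>z. z \<in> U \<Longrightarrow> z \<in> cball a r0 \<Longrightarrow> f c \<le> f z" by auto
  have "f c \<le> f w" if "w \<in> U" for w
  proof (cases "w \<in> cball a r0")
    case False
    then have "f a \<le> f w" by (intro far) (simp add: dist_norm norm_minus_commute)
    moreover have "f c \<le> f a" using c(2)[OF a] r0 by simp
    ultimately show ?thesis by simp
  qed (use c that in auto)
  with c(1) show ?thesis by (rule that)
qed

text \<open>
  Compare the minimiser \<open>u\<close> with the points \<open>t w + (1 - t) u\<close> of the segment to \<open>w\<close>.  After
  division by \<open>t\<close>, strong convexity gives the claim with an extra factor \<open>1 - t\<close>, which tends to 1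
  as \<open>t\<close> tends to 0.
\<close>
lemma strongly_convex_quadratic_growth:
  assumes sc: "strongly_convex \<sigma> f" and "convex U"
    and u: "u \<in> U" "\<And>w. w \<in> U \<Longrightarrow> f u \<le> f w" and w: "w \<in> U"
  shows "f u + \<sigma> / 2 * (norm (w - u))\<^sup>2 \<le> f w"
proof -
  have "s * (\<sigma> / 2 * (norm (w - u))\<^sup>2) \<le> f w - f u" if s: "0 < s" "s < 1" for s
  proof -
    define t where "t = 1 - s"
    have t: "0 < t" "t < 1" using s by (auto simp: t_def)
    have "f u \<le> f (t *\<^sub>R w + (1 - t) *\<^sub>R u)"
      using u w t \<open>convex U\<close> by (intro u(2) convexD) auto
    also have "\<dots> \<le> t * f w + (1 - t) * f u - \<sigma> / 2 * t * (1 - t) * (norm (w - u))\<^sup>2"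
      using sc t unfolding strongly_convex_def by auto
    finally have "0 \<le> t * (f w - f u - (1 - t) * (\<sigma> / 2 * (norm (w - u))\<^sup>2))"
      by (simp add: algebra_simps)
    then show ?thesis using t by (simp add: zero_le_mult_iff t_def)
  qed
  then have "\<sigma> / 2 * (norm (w - u))\<^sup>2 \<le> f w - f u" by (rule field_le_mult_one_interval)
  then show ?thesis by linarith
qed

section \<open>The dual function\<close>

lemma closed_dual_cone: "closed (dual_cone K)"
proof -
  have "dual_cone K = (\<Inter>z\<in>K. {x. z \<bullet> x \<ge> 0})" by (auto simp: dual_cone_def inner_commute)
  then show ?thesis by (auto intro: closed_halfspace_ge)
qed

lemma convex_dual_cone: "convex (dual_cone K)"
  by (auto simp: convex_def dual_cone_def inner_add_left)

lemma norm_matrix_vector_le: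
  fixes G :: "real^'n^'p"
  shows "norm (G *v w) \<le> onorm ((*v) G) * norm w"
  by (intro onorm matrix_vector_mul_bounded_linear)

lemma strongly_convex_lagrangian:
  assumes "strongly_convex \<sigma> f"
  shows "strongly_convex \<sigma> (\<lambda>u. lagrangian f G g u x)"
  unfolding strongly_convex_def
proof (intro allI impI)
  fix w z and t :: real
  assume t: "0 \<le> t" "t \<le> 1"
  have "G *v (t *\<^sub>R w + (1 - t) *\<^sub>R z) + g = t *\<^sub>R (G *v w + g) + (1 - t) *\<^sub>R (G *v z + g)"
    by (simp add: matrix_vector_right_distrib matrix_vector_mult_scaleR algebra_simps)
  then show "lagrangian f G g (t *\<^sub>R w + (1 - t) *\<^sub>R z) x
      \<le> t * lagrangian f G g w x + (1 - t) * lagrangian f G g z x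
        - \<sigma> / 2 * t * (1 - t) * (norm (w - z))\<^sup>2"
    using assms[unfolded strongly_convex_def, rule_format, OF t, of w z]
    by (simp add: lagrangian_def inner_add_right algebra_simps)
qed

lemma lagrangian_change_multiplier:
  "lagrangian f G g u z = lagrangian f G g u y + (- (G *v u) - g) \<bullet> (z - y)"
  by (simp add: lagrangian_def inner_simps inner_commute)

locale strongly_convex_program =
  fixes f :: "real^'n \<Rightarrow> real" and \<sigma> :: real
    and G :: "real^'n^'p" and g :: "real^'p" and U :: "(real^'n) set"
  assumes \<sigma>_pos: "\<sigma> > 0" and sc: "strongly_convex \<sigma> f" and G_nonzero: "G \<noteq> 0"
    and U: "U \<noteq> {}" "closed U" "convex U"
begin

abbreviation "L \<equiv> dual_lipschitz \<sigma> G"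
abbreviation "lag \<equiv> lagrangian f G g"
abbreviation "d \<equiv> dual_fun f G g U"
abbreviation "umin \<equiv> lagr_argmin f G g U"

lemma L_pos: "L > 0"
proof -
  obtain w where "G *v w \<noteq> 0" using G_nonzero by (metis matrix_eq matrix_vector_mult_0)
  then have "onorm ((*v) G) \<noteq> 0"
    using norm_matrix_vector_le[of G w] by auto
  then show ?thesis using \<sigma>_pos by (simp add: dual_lipschitz_def)
qed

lemma umin_in: "umin x \<in> U" and umin_le: "w \<in> U \<Longrightarrow> lag (umin x) x \<le> lag w x"
proof -
  obtain m where "m \<in> U" "\<And>w. w \<in> U \<Longrightarrow> lag m x \<le> lag w x"
    by (rule strongly_convex_attains_min[OF strongly_convex_lagrangian[OF sc] \<sigma>_pos U(1,2)]) blast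
  then have "is_arg_min (\<lambda>u. lag u x) (\<lambda>u. u \<in> U) m"
    by (force simp: is_arg_min_linorder)
  then have "is_arg_min (\<lambda>u. lag u x) (\<lambda>u. u \<in> U) (umin x)"
    unfolding lagr_argmin_def arg_min_on_def arg_min_def by (rule someI)
  then show "umin x \<in> U" and "w \<in> U \<Longrightarrow> lag (umin x) x \<le> lag w x"
    by (auto simp: is_arg_min_linorder)
qed

lemma dual_eq: "d x = lag (umin x) x"
  unfolding dual_fun_def by (rule cInf_eq_minimum) (auto intro: umin_in umin_le)

lemma lagrangian_growth:
  assumes "w \<in> U"
  shows "d x + \<sigma> / 2 * (norm (w - umin x))\<^sup>2 \<le> lag w x"
  unfolding dual_eq
  using strongly_convex_quadratic_growth[OF strongly_convex_lagrangian[OF sc] U(3) umin_in umin_le assms] .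

definition dgrad :: "real^'p \<Rightarrow> real^'p" where
  "dgrad y = - (G *v umin y) - g"

text \<open>
  \<open>umin y\<close> is a competitor in the minimisation that defines \<open>d z\<close>, and its Lagrangian is affine in
  the multiplier.
\<close>
lemma dual_le_linearization: "d z \<le> d y + dgrad y \<bullet> (z - y)"
  using umin_le[OF umin_in, of z y] lagrangian_change_multiplier[of f G g "umin y" z y]
  by (simp add: dual_eq dgrad_def)

text \<open>
  Evaluate \<open>d z\<close> at its own minimiser.  Moving the multiplier from \<open>z\<close> back to \<open>y\<close> costs the
  cross term \<open>(z - y) \<bullet> G (umin z - umin y)\<close>.  The quadratic growth of the Lagrangian at \<open>y\<close>
  absorbs it by \<open>a b \<le> a\<^sup>2/(2\<sigma>) + \<sigma> b\<^sup>2/2\<close>, which is where the constant \<open>\<parallel>G\<parallel>\<^sup>2/\<sigma>\<close> comes from.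
\<close>
lemma dual_ge_quadratic: "d y + dgrad y \<bullet> (z - y) - L / 2 * (norm (z - y))\<^sup>2 \<le> d z"
proof -
  define n where "n = norm (umin z - umin y)"
  define a where "a = onorm ((*v) G) * norm (z - y)"
  have "(G *v (umin z - umin y)) \<bullet> (z - y) \<le> norm (G *v (umin z - umin y)) * norm (z - y)"
    by (rule norm_cauchy_schwarz)
  also have "\<dots> \<le> (onorm ((*v) G) * n) * norm (z - y)"
    unfolding n_def by (intro mult_right_mono norm_matrix_vector_le) simp
  also have "\<dots> = a * n" by (simp add: a_def)
  also have "a * n \<le> a\<^sup>2 / (2 * \<sigma>) + \<sigma> / 2 * n\<^sup>2"
  proof -
    have "0 \<le> (a - \<sigma> * n)\<^sup>2 / (2 * \<sigma>)" using \<sigma>_pos by simp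
    also have "\<dots> = a\<^sup>2 / (2 * \<sigma>) + \<sigma> / 2 * n\<^sup>2 - a * n"
      using \<sigma>_pos by (simp add: power2_diff field_simps power2_eq_square)
    finally show ?thesis by simp
  qed
  also have "a\<^sup>2 / (2 * \<sigma>) = L / 2 * (norm (z - y))\<^sup>2"
    by (simp add: a_def dual_lipschitz_def power_mult_distrib)
  finally have cross: "(G *v (umin z - umin y)) \<bullet> (z - y)
      \<le> L / 2 * (norm (z - y))\<^sup>2 + \<sigma> / 2 * n\<^sup>2" .
  have "d z = lag (umin z) y + (- (G *v umin z) - g) \<bullet> (z - y)"
    unfolding dual_eq by (rule lagrangian_change_multiplier)
  also have "(- (G *v umin z) - g) \<bullet> (z - y)
      = dgrad y \<bullet> (z - y) - (G *v (umin z - umin y)) \<bullet> (z - y)"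
    by (simp add: dgrad_def inner_diff_left matrix_vector_mult_diff_distrib)
  finally show ?thesis
    using cross lagrangian_growth[OF umin_in, of y z] by (simp add: n_def)
qed

text \<open>
  By the two bounds above, the first-order remainder of \<open>d\<close> at \<open>y\<close> is quadratic in the increment.
\<close>
lemma gradient_dual: "gradient d y = dgrad y"
proof -
  have "((\<lambda>z. L / 2 * norm (z - y)) \<longlongrightarrow> L / 2 * norm (y - y)) (at y)"
    by (intro tendsto_intros)
  then have lim: "((\<lambda>z. L / 2 * norm (z - y)) \<longlongrightarrow> 0) (at y)" by simp
  have "((\<lambda>z. norm (d z - d y - (z - y) \<bullet> dgrad y) / norm (z - y)) \<longlongrightarrow> 0) (at y)"
  proof (rule tendsto_sandwich[OF _ _ tendsto_const lim])
    show "\<forall>\<^sub>F z in at y. norm (d z - d y - (z - y) \<bullet> dgrad y) / norm (z - y)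
        \<le> L / 2 * norm (z - y)"
    proof (intro always_eventually allI)
      fix z
      have "\<bar>d z - d y - (z - y) \<bullet> dgrad y\<bar> \<le> L / 2 * (norm (z - y))\<^sup>2"
        using dual_ge_quadratic[of y z] dual_le_linearization[of z y] L_pos
        by (auto simp: inner_commute abs_le_iff intro: order_trans[of _ 0])
      then show "norm (d z - d y - (z - y) \<bullet> dgrad y) / norm (z - y) \<le> L / 2 * norm (z - y)"
        by (cases "z = y") (simp_all add: field_simps power2_eq_square)
    qed
  qed simp
  then have D: "GDERIV d y :> dgrad y"
    unfolding gderiv_def has_derivative_iff_norm by (simp add: bounded_linear_inner_left)
  show ?thesis
    unfolding gradient_def
  proof (rule the_equality)
    show "GDERIV d y :> dgrad y" by (rule D)
    fix D' assume "GDERIV d y :> D'"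
    then have "(\<lambda>h. h \<bullet> D') = (\<lambda>h. h \<bullet> dgrad y)"
      using D unfolding gderiv_def by (rule has_derivative_unique)
    then show "D' = dgrad y" by (metis inner_commute vector_eq_rdot)
  qed
qed

text \<open>
  For a multiplier in the dual cone, the Lagrangian at a feasible \<open>w\<close> is at most \<open>f w\<close>.  A small
  dual gap therefore leaves little room for quadratic growth between \<open>umin x\<close> and a primal solution.
\<close>
lemma argmin_dist_le_gap:
  assumes "x \<in> dual_cone K" and "w \<in> feasible_set G g K U"
  shows "\<sigma> / 2 * (norm (umin x - w))\<^sup>2 \<le> f w - d x"
proof -
  have "w \<in> U" "0 \<le> x \<bullet> (G *v w + g)"
    using assms by (auto simp: feasible_set_def dual_cone_def)
  then show ?thesis
    using lagrangian_growth[of w x] by (simp add: lagrangian_def norm_minus_commute)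
qed

end

section \<open>Accelerated projected gradient ascent\<close>

text \<open>
  The hypotheses \<open>upper\<close> and \<open>lower\<close> say that \<open>d\<close> is concave and \<open>L\<close>-smooth with gradient \<open>D\<close>.
  Chaining them through \<open>y\<close> and using the variational inequality of the projection, the two linear
  terms combine into a difference of squared distances.
\<close>
lemma projected_gradient_step:
  fixes d :: "'a::euclidean_space \<Rightarrow> real" and D :: "'a \<Rightarrow> 'a"
  assumes upper: "\<And>z y. d z \<le> d y + D y \<bullet> (z - y)"
    and lower: "\<And>z y. d y + D y \<bullet> (z - y) - L / 2 * (norm (z - y))\<^sup>2 \<le> d z"
    and L: "L > 0" and C: "convex C" "closed C" and w: "w \<in> C"
    and x: "x = closest_point C (y + (1 / L) *\<^sub>R D y)"
  shows "d w - d x \<le> L / 2 * ((norm (y - w))\<^sup>2 - (norm (x - w))\<^sup>2)"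
proof -
  have "L * ((y + (1 / L) *\<^sub>R D y - x) \<bullet> (w - x)) \<le> 0"
    using closest_point_dot[OF C w, of "y + (1 / L) *\<^sub>R D y"] x L by (simp add: mult_le_0_iff)
  then have "D y \<bullet> (w - x) \<le> L * ((x - y) \<bullet> (w - x))"
    using L by (simp add: inner_simps algebra_simps)
  moreover have "d w - d x \<le> D y \<bullet> (w - x) + L / 2 * (norm (x - y))\<^sup>2"
    using upper[of w y] lower[of y x] by (simp add: inner_diff_right)
  moreover have "L * ((x - y) \<bullet> (w - x)) + L / 2 * (norm (x - y))\<^sup>2
      = L / 2 * ((norm (y - w))\<^sup>2 - (norm (x - w))\<^sup>2)"
    by (simp add: power2_norm_eq_inner inner_simps inner_commute algebra_simps)
  ultimately show ?thesis by linarith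
qed

text \<open>
  Linearise at the convex combination itself: the weighted linear terms cancel.
\<close>
lemma concave_from_linearization:
  fixes d :: "'a::real_inner \<Rightarrow> real"
  assumes upper: "\<And>z y. d z \<le> d y + D y \<bullet> (z - y)" and t: "0 \<le> t" "t \<le> 1"
  shows "(1 - t) * d a + t * d b \<le> d ((1 - t) *\<^sub>R a + t *\<^sub>R b)"
proof -
  define w where "w = (1 - t) *\<^sub>R a + t *\<^sub>R b"
  have "(1 - t) * d a + t * d b \<le> (1 - t) * (d w + D w \<bullet> (a - w)) + t * (d w + D w \<bullet> (b - w))"
    using t by (intro add_mono mult_left_mono upper) auto
  also have "\<dots> = d w + D w \<bullet> ((1 - t) *\<^sub>R (a - w) + t *\<^sub>R (b - w))"
    by (simp add: inner_add_right algebra_simps)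
  also have "(1 - t) *\<^sub>R (a - w) + t *\<^sub>R (b - w) = 0"
    by (simp add: w_def algebra_simps)
  finally show ?thesis by (simp add: w_def)
qed

locale momentum_parameters =
  fixes \<theta> :: "nat \<Rightarrow> real"
  assumes \<theta>_1: "\<theta> 1 = 1"
    and \<theta>_step: "\<And>k. k \<ge> 1 \<Longrightarrow> \<theta> (k + 1) = (1 + sqrt (1 + 4 * (\<theta> k)\<^sup>2)) / 2"
begin

lemma \<theta>_lower: "k \<ge> 1 \<Longrightarrow> (real k + 1) / 2 \<le> \<theta> k"
proof (induction k rule: dec_induct)
  case base
  then show ?case using \<theta>_1 by simp
next
  case (step k)
  have "2 * \<theta> k \<le> sqrt (1 + 4 * (\<theta> k)\<^sup>2)"
    by (rule real_le_rsqrt) (simp add: power_mult_distrib)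
  then show ?case using step.IH \<theta>_step[OF step.hyps(1)] by simp
qed

lemma \<theta>_ge_1: "k \<ge> 1 \<Longrightarrow> \<theta> k \<ge> 1"
  using \<theta>_lower[of k] by simp

lemma \<theta>_square: "k \<ge> 1 \<Longrightarrow> (\<theta> (k + 1))\<^sup>2 - \<theta> (k + 1) = (\<theta> k)\<^sup>2"
proof -
  assume "k \<ge> 1"
  then have s: "sqrt (1 + 4 * (\<theta> k)\<^sup>2) = 2 * \<theta> (k + 1) - 1" using \<theta>_step[of k] by (simp add: field_simps)
  have "(2 * \<theta> (k + 1) - 1)\<^sup>2 = 1 + 4 * (\<theta> k)\<^sup>2"
    by (subst s[symmetric]) simp
  then show ?thesis by (simp add: power2_eq_square algebra_simps)
qed

end

locale accelerated_ascent = momentum_parameters \<theta> for \<theta> +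
  fixes d :: "'a::euclidean_space \<Rightarrow> real" and D :: "'a \<Rightarrow> 'a" and L :: real and C :: "'a set"
    and x y :: "nat \<Rightarrow> 'a"
  assumes upper: "\<And>z y. d z \<le> d y + D y \<bullet> (z - y)"
    and lower: "\<And>z y. d y + D y \<bullet> (z - y) - L / 2 * (norm (z - y))\<^sup>2 \<le> d z"
    and L: "L > 0" and C: "convex C" "closed C"
    and x_0: "x 0 \<in> C" and y_1: "y 1 = x 0"
    and x_step: "\<And>k. k \<ge> 1 \<Longrightarrow> x k = closest_point C (y k + (1 / L) *\<^sub>R D (y k))"
    and y_step: "\<And>k. k \<ge> 1 \<Longrightarrow> y (k + 1) = x k + ((\<theta> k - 1) / \<theta> (k + 1)) *\<^sub>R (x k - x (k - 1))"
begin

lemma x_in: "x k \<in> C"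
proof (cases "k = 0")
  case False
  then have "x k = closest_point C (y k + (1 / L) *\<^sub>R D (y k))" by (intro x_step) simp
  then show ?thesis using closest_point_in_set[OF C(2)] x_0 by auto
qed (simp add: x_0)

text \<open>
  This is \<open>x (k - 1) + \<theta> k (x k - x (k - 1))\<close>, the step from \<open>x (k - 1)\<close> to \<open>x k\<close> stretched by
  \<open>\<theta> k\<close>.  In the potential, its distance to the comparison point replaces that of \<open>x k\<close>.
\<close>
definition z :: "nat \<Rightarrow> 'a" where
  "z k = \<theta> k *\<^sub>R x k - (\<theta> k - 1) *\<^sub>R x (k - 1)"

text \<open>
  The momentum coefficient in \<open>y (k + 1)\<close> is chosen to make this true: the squared distance with
  which the step \<open>k + 1\<close> starts is the one with which the step \<open>k\<close> ended.
\<close>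
lemma z_eq_y:
  assumes "k \<ge> 1"
  shows "\<theta> (k + 1) *\<^sub>R y (k + 1) - (\<theta> (k + 1) - 1) *\<^sub>R x k = z k"
proof -
  have "\<theta> (k + 1) \<noteq> 0" using \<theta>_ge_1[of "k + 1"] by auto
  then have "\<theta> (k + 1) *\<^sub>R y (k + 1) = \<theta> (k + 1) *\<^sub>R x k + (\<theta> k - 1) *\<^sub>R (x k - x (k - 1))"
    using y_step[OF assms] by (simp add: scaleR_right_distrib)
  then show ?thesis by (simp add: z_def algebra_simps)
qed

text \<open>
  Apply the step estimate with the comparison point \<open>(1 - 1/\<theta> k) x (k - 1) + (1/\<theta> k) s\<close> and
  multiply by \<open>(\<theta> k)\<^sup>2\<close>.  By concavity, this mixture relates the gap at \<open>x k\<close> to the gap at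
  \<open>x (k - 1)\<close>, with the smaller weight \<open>(\<theta> k)\<^sup>2 - \<theta> k\<close>.
\<close>
lemma one_step:
  assumes k: "k \<ge> 1" and s: "s \<in> C"
  shows "(\<theta> k)\<^sup>2 * (d s - d (x k)) - ((\<theta> k)\<^sup>2 - \<theta> k) * (d s - d (x (k - 1)))
     \<le> L / 2 * ((norm (\<theta> k *\<^sub>R y k - (\<theta> k - 1) *\<^sub>R x (k - 1) - s))\<^sup>2 - (norm (z k - s))\<^sup>2)"
proof -
  define p where "p = \<theta> k"
  have p: "p \<ge> 1" using \<theta>_ge_1[OF k] by (simp add: p_def)
  define w where "w = (1 - 1 / p) *\<^sub>R x (k - 1) + (1 / p) *\<^sub>R s"
  have w: "w \<in> C" unfolding w_def using p s x_in C by (intro convexD) auto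
  have "(1 - 1 / p) * d (x (k - 1)) + 1 / p * d s \<le> d w"
    unfolding w_def using p by (intro concave_from_linearization[OF upper]) auto
  then have "(1 - 1 / p) * d (x (k - 1)) + 1 / p * d s - d (x k)
      \<le> L / 2 * ((norm (y k - w))\<^sup>2 - (norm (x k - w))\<^sup>2)"
    using projected_gradient_step[OF upper lower L C w x_step[OF k]] by linarith
  then have le: "p\<^sup>2 * ((1 - 1 / p) * d (x (k - 1)) + 1 / p * d s - d (x k))
      \<le> p\<^sup>2 * (L / 2 * ((norm (y k - w))\<^sup>2 - (norm (x k - w))\<^sup>2))"
    by (rule mult_left_mono) simp
  have lhs: "p\<^sup>2 * ((1 - 1 / p) * d (x (k - 1)) + 1 / p * d s - d (x k))
      = p\<^sup>2 * (d s - d (x k)) - (p\<^sup>2 - p) * (d s - d (x (k - 1)))"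
    using p by (simp add: field_simps power2_eq_square)
  have scale: "p\<^sup>2 * (norm (q - w))\<^sup>2 = (norm (p *\<^sub>R q - (p - 1) *\<^sub>R x (k - 1) - s))\<^sup>2" for q
  proof -
    have "p *\<^sub>R q - (p - 1) *\<^sub>R x (k - 1) - s = p *\<^sub>R (q - w)"
      using p by (simp add: w_def algebra_simps)
    then show ?thesis by (simp add: power_mult_distrib)
  qed
  have rhs: "p\<^sup>2 * (L / 2 * ((norm (y k - w))\<^sup>2 - (norm (x k - w))\<^sup>2))
      = L / 2 * (p\<^sup>2 * (norm (y k - w))\<^sup>2 - p\<^sup>2 * (norm (x k - w))\<^sup>2)"
    by (simp add: algebra_simps)
  show ?thesis using le unfolding lhs rhs scale by (simp only: z_def p_def)
qed

text \<open>
  By \<open>(\<theta> (k + 1))\<^sup>2 - \<theta> (k + 1) = (\<theta> k)\<^sup>2\<close> and \<open>z_eq_y\<close>, the one-step estimates telescope.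
  The sum starts cleanly: \<open>\<theta> 1 = 1\<close> gives the gap at \<open>x 0\<close> the weight 0.
\<close>
lemma accelerated_potential:
  assumes s: "s \<in> C" and "k \<ge> 1"
  shows "(\<theta> k)\<^sup>2 * (d s - d (x k)) + L / 2 * (norm (z k - s))\<^sup>2 \<le> L / 2 * (norm (x 0 - s))\<^sup>2"
  using \<open>k \<ge> 1\<close>
proof (induction k rule: dec_induct)
  case base
  show ?case using one_step[OF order_refl s] by (simp add: \<theta>_1 y_1[simplified] \<theta>_1[simplified] algebra_simps)
next
  case (step k)
  have "(\<theta> (k + 1))\<^sup>2 * (d s - d (x (k + 1))) - (\<theta> k)\<^sup>2 * (d s - d (x k))
      \<le> L / 2 * ((norm (z k - s))\<^sup>2 - (norm (z (k + 1) - s))\<^sup>2)"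
    using one_step[OF _ s, of "k + 1"] z_eq_y[OF step.hyps(1)] \<theta>_square[OF step.hyps(1)] by simp
  then show ?case using step.IH by (simp add: algebra_simps)
qed

text \<open>
  The weight of the gap in the potential is at least \<open>((k + 1)/2)\<^sup>2\<close>; when the gap is negative,
  the right-hand side is larger by its sign.
\<close>
lemma dual_gap_rate:
  assumes s: "s \<in> C" and k: "k \<ge> 1"
  shows "d s - d (x k) \<le> 2 * L * (norm (x 0 - s))\<^sup>2 / (real k + 1)\<^sup>2"
proof (cases "d s - d (x k) \<ge> 0")
  case True
  have "((real k + 1) / 2)\<^sup>2 * (d s - d (x k)) \<le> (\<theta> k)\<^sup>2 * (d s - d (x k))"
    using True \<theta>_lower[OF k] by (intro mult_right_mono power_mono) auto
  also have "\<dots> \<le> L / 2 * (norm (x 0 - s))\<^sup>2"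
  proof -
    have "0 \<le> L / 2 * (norm (z k - s))\<^sup>2" using L by simp
    then show ?thesis using accelerated_potential[OF s k] by linarith
  qed
  finally have "(d s - d (x k)) * (real k + 1)\<^sup>2 \<le> 2 * L * (norm (x 0 - s))\<^sup>2"
    by (simp add: power_divide algebra_simps)
  then show ?thesis by (simp add: pos_le_divide_eq)
next
  case False
  have "0 \<le> 2 * L * (norm (x 0 - s))\<^sup>2 / (real k + 1)\<^sup>2" using L by simp
  then show ?thesis using False by linarith
qed

text \<open>
  At a maximiser \<open>s\<close> the gap part of the potential is nonnegative, so the distance part alone keeps
  every \<open>z k\<close> in the ball of radius \<open>\<parallel>x 0 - s\<parallel>\<close> around \<open>s\<close>; and \<open>x k\<close> is a convex
  combination of \<open>z k\<close> and \<open>x (k - 1)\<close>.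
\<close>
lemma iterates_bounded:
  assumes s: "s \<in> C" and max: "\<And>w. w \<in> C \<Longrightarrow> d w \<le> d s"
  shows "norm (x k - s) \<le> norm (x 0 - s)"
proof (induction k)
  case (Suc k)
  define p where "p = \<theta> (Suc k)"
  have p: "p \<ge> 1" using \<theta>_ge_1[of "Suc k"] by (simp add: p_def)
  have "0 \<le> (\<theta> (Suc k))\<^sup>2 * (d s - d (x (Suc k)))" using max[OF x_in] by simp
  then have "L / 2 * (norm (z (Suc k) - s))\<^sup>2 \<le> L / 2 * (norm (x 0 - s))\<^sup>2"
    using accelerated_potential[OF s, of "Suc k"] by linarith
  then have "(norm (z (Suc k) - s))\<^sup>2 \<le> (norm (x 0 - s))\<^sup>2" using L by simp
  then have z: "norm (z (Suc k) - s) \<le> norm (x 0 - s)" by (simp add: power2_le_iff_abs_le)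
  have "p *\<^sub>R (x (Suc k) - s) = (z (Suc k) - s) + (p - 1) *\<^sub>R (x k - s)"
    by (simp add: z_def p_def algebra_simps)
  then have "p * norm (x (Suc k) - s) = norm ((z (Suc k) - s) + (p - 1) *\<^sub>R (x k - s))"
    using p by (metis norm_scaleR abs_of_nonneg order_trans zero_le_one)
  also have "\<dots> \<le> norm (z (Suc k) - s) + norm ((p - 1) *\<^sub>R (x k - s))" by (rule norm_triangle_ineq)
  also have "\<dots> = norm (z (Suc k) - s) + (p - 1) * norm (x k - s)" using p by simp
  also have "\<dots> \<le> norm (x 0 - s) + (p - 1) * norm (x 0 - s)"
    using p z Suc.IH by (intro add_mono mult_left_mono) auto
  also have "\<dots> = p * norm (x 0 - s)" by (simp add: algebra_simps)
  finally show ?case using p by simp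
qed simp

end

section \<open>Recovering the primal solution\<close>

theorem theorem4p3:
  fixes f :: "real^'n \<Rightarrow> real" and \<sigma> :: real
    and G :: "real^'n^'p" and g :: "real^'p"
    and K :: "(real^'p) set" and U :: "(real^'n) set"
    and x y :: "nat \<Rightarrow> real^'p" and u v :: "nat \<Rightarrow> real^'n" and \<theta> :: "nat \<Rightarrow> real"
  assumes "\<sigma> > 0" and "strongly_convex \<sigma> f"
    and "G \<noteq> 0"
    and "proper_cone K"
    and "U \<noteq> {}" and "closed U" and "convex U"
    and "feasible_set G g K U \<noteq> {}"
    and "\<exists>xs \<in> dual_optimal_set f G g K U. dual_fun f G g U xs = opt_val f G g K U"
    and "dfg_sequence f \<sigma> G g K U x y u \<theta>"
    and "\<And>k. k \<ge> 1 \<Longrightarrow> v k = lagr_argmin f G g U (x k)"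
  shows "\<exists>C1>0. \<exists>C2>0. \<forall>\<epsilon>>0. \<forall>k\<ge>1. real k \<ge> C1 / \<epsilon> \<longrightarrow>
           v k \<in> U \<and>
           infdist (G *v v k + g) K \<le> C2 * \<epsilon> \<and>
           - (C2 * \<epsilon>) \<le> f (v k) - opt_val f G g K U \<and>
           f (v k) - opt_val f G g K U \<le> C2 * \<epsilon>"
proof -
  interpret strongly_convex_program f \<sigma> G g U
    using assms by unfold_locales auto
  let ?C = "dual_cone K"
  have dfg: "x 0 \<in> ?C" "y 1 = x 0" "\<theta> 1 = 1"
    "\<And>k. k \<ge> 1 \<Longrightarrow> x k = closest_point ?C (y k + (1 / L) *\<^sub>R dgrad (y k))"
    "\<And>k. k \<ge> 1 \<Longrightarrow> \<theta> (k + 1) = (1 + sqrt (1 + 4 * (\<theta> k)\<^sup>2)) / 2"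
    "\<And>k. k \<ge> 1 \<Longrightarrow> y (k + 1) = x k + ((\<theta> k - 1) / \<theta> (k + 1)) *\<^sub>R (x k - x (k - 1))"
    using assms(10) unfolding dfg_sequence_def gradient_dual by auto
  interpret acc: accelerated_ascent \<theta> d dgrad L ?C x y
    by unfold_locales
      (fact dfg dual_le_linearization dual_ge_quadratic L_pos convex_dual_cone closed_dual_cone)+
  obtain xs where xs: "xs \<in> ?C" "\<And>w. w \<in> ?C \<Longrightarrow> d w \<le> d xs" "d xs = opt_val f G g K U"
    using assms(9) by (auto simp: dual_optimal_set_def is_arg_max_linorder)
  obtain us where us: "us \<in> feasible_set G g K U"
    and us_min: "\<And>w. w \<in> feasible_set G g K U \<Longrightarrow> f us \<le> f w"
  proof (rule strongly_convex_attains_min[OF assms(2,1) assms(8)])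
    have "continuous_on UNIV (\<lambda>u. G *v u + g)" by (intro continuous_intros)
    moreover have "closed K" using assms(4) by (simp add: proper_cone_def)
    ultimately have "closed ((\<lambda>u. G *v u + g) -` K)" by (intro closed_vimage) auto
    moreover have "feasible_set G g K U = U \<inter> (\<lambda>u. G *v u + g) -` K"
      by (auto simp: feasible_set_def)
    ultimately show "closed (feasible_set G g K U)" using U(2) by auto
  qed blast
  have opt: "opt_val f G g K U = f us"
    unfolding opt_val_def by (rule cInf_eq_minimum) (use us us_min in auto)
  have usK: "G *v us + g \<in> K" and usU: "us \<in> U" using us by (auto simp: feasible_set_def)
  define R where "R = norm (x 0 - xs)"
  define B where "B = 2 * L * R"
  have B: "B \<ge> 0" using L_pos by (simp add: B_def R_def)
  \<comment> \<open>\<open>B \<epsilon>\<close> will bound the norm of \<open>G (v k - us)\<close>.  It is paired with \<open>x k\<close> and with \<open>xs\<close>, both of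
    norm at most \<open>R + norm xs\<close>; the last summand makes \<open>C2\<close> positive when \<open>B\<close> vanishes.\<close>
  define C2 where "C2 = B * (R + norm xs + 1) + 1"
  have C2: "C2 > 0" using B by (auto simp: C2_def R_def intro!: add_nonneg_pos)
  have bounds: "v k \<in> U \<and> infdist (G *v v k + g) K \<le> C2 * \<epsilon> \<and>
      - (C2 * \<epsilon>) \<le> f (v k) - f us \<and> f (v k) - f us \<le> C2 * \<epsilon>"
    if \<epsilon>: "\<epsilon> > 0" and k: "k \<ge> 1" "real k \<ge> 1 / \<epsilon>" for k \<epsilon>
  proof -
    have v: "v k = umin (x k)" using assms(11) k by simp
    define h where "h = G *v (v k - us)"
    have Gv: "G *v v k + g = (G *v us + g) + h" by (simp add: h_def matrix_vector_mult_diff_distrib)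
    have "\<sigma> / 2 * (norm (v k - us))\<^sup>2 \<le> f us - d (x k)"
      unfolding v by (rule argmin_dist_le_gap[OF acc.x_in us])
    also have "\<dots> \<le> 2 * L * R\<^sup>2 / (real k + 1)\<^sup>2"
      using acc.dual_gap_rate[OF xs(1) k(1)] xs(3) opt by (simp add: R_def)
    finally have "(onorm ((*v) G))\<^sup>2 * (norm (v k - us))\<^sup>2
        \<le> (onorm ((*v) G))\<^sup>2 * (2 / \<sigma> * (2 * L * R\<^sup>2 / (real k + 1)\<^sup>2))"
      using \<sigma>_pos by (intro mult_left_mono) (auto simp: field_simps)
    \<comment> \<open>\<open>\<parallel>G\<parallel>\<^sup>2/\<sigma>\<close> is \<open>L\<close> again, so the right-hand side is the square of \<open>2 L R/(k + 1)\<close>.\<close>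
    also have "\<dots> = (B / (real k + 1))\<^sup>2"
      by (simp add: B_def dual_lipschitz_def power_divide power2_eq_square field_simps)
    finally have "(onorm ((*v) G) * norm (v k - us))\<^sup>2 \<le> (B / (real k + 1))\<^sup>2"
      by (simp add: power_mult_distrib)
    then have "onorm ((*v) G) * norm (v k - us) \<le> B / (real k + 1)"
      by (rule power2_le_imp_le) (use B in simp)
    then have "norm h \<le> B / (real k + 1)"
      unfolding h_def using norm_matrix_vector_le order_trans by blast
    also have "B / (real k + 1) = B * (1 / (real k + 1))" by simp
    also have "\<dots> \<le> B * \<epsilon>"
    proof (rule mult_left_mono[OF _ B])
      have "1 \<le> real k * \<epsilon>" using k(2) \<epsilon> by (simp add: field_simps)
      then have "1 \<le> \<epsilon> * (real k + 1)" using \<epsilon> by (simp add: algebra_simps)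
      then show "1 / (real k + 1) \<le> \<epsilon>" by (simp add: pos_divide_le_eq)
    qed
    finally have h: "norm h \<le> B * \<epsilon>" .
    have C2_ge: "M * (B * \<epsilon>) \<le> C2 * \<epsilon>" if "M \<le> R + norm xs + 1" for M
    proof -
      have "B * M \<le> C2" using mult_left_mono[OF that B] by (simp add: C2_def)
      then have "B * M * \<epsilon> \<le> C2 * \<epsilon>" using \<epsilon> by (intro mult_right_mono) auto
      then show ?thesis by (simp add: algebra_simps)
    qed
    have inner_le: "\<bar>w \<bullet> h\<bar> \<le> C2 * \<epsilon>" if "norm w \<le> R + norm xs" for w
    proof -
      have "\<bar>w \<bullet> h\<bar> \<le> norm w * norm h" by (rule Cauchy_Schwarz_ineq2)
      also have "\<dots> \<le> norm w * (B * \<epsilon>)" using h by (intro mult_left_mono) auto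
      also have "\<dots> \<le> C2 * \<epsilon>" using that by (intro C2_ge) auto
      finally show ?thesis .
    qed
    have "infdist (G *v v k + g) K \<le> dist (G *v v k + g) (G *v us + g)"
      by (rule infdist_le[OF usK])
    also have "\<dots> = norm h" unfolding Gv by (simp add: dist_norm)
    also have "\<dots> \<le> C2 * \<epsilon>" using h C2_ge[of 1] by (simp add: R_def)
    finally have feas: "infdist (G *v v k + g) K \<le> C2 * \<epsilon>" .
    have "norm (x k) \<le> norm (x k - xs) + norm xs" using norm_triangle_sub[of "x k" xs] by simp
    also have "norm (x k - xs) \<le> R"
      unfolding R_def by (rule acc.iterates_bounded[OF xs(1,2)])
    finally have xk: "\<bar>x k \<bullet> h\<bar> \<le> C2 * \<epsilon>" by (intro inner_le) simp
    have "f (v k) - f us \<le> x k \<bullet> h"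
      using umin_le[OF usU, of "x k"] unfolding v[symmetric] lagrangian_def Gv
      by (simp add: inner_add_right)
    then have up: "f (v k) - f us \<le> C2 * \<epsilon>" using xk by linarith
    have vU: "v k \<in> U" unfolding v by (rule umin_in)
    have "f us \<le> lag (v k) xs"
      using umin_le[OF vU, of xs] xs(3) opt by (simp add: dual_eq)
    moreover have "0 \<le> xs \<bullet> (G *v us + g)" using xs(1) usK by (simp add: dual_cone_def)
    ultimately have "xs \<bullet> h \<le> f (v k) - f us"
      unfolding lagrangian_def Gv by (simp add: inner_add_right)
    moreover have "\<bar>xs \<bullet> h\<bar> \<le> C2 * \<epsilon>" by (rule inner_le) (simp add: R_def)
    ultimately show ?thesis using feas up vU by auto
  qed
  show ?thesis
    unfolding opt using bounds C2 by (intro exI[of _ "1::real"] conjI exI[of _ C2]) auto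
qed

end
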